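(* Suppose that for all $u\in U$ the matrix $\nabla_x^2 f(x^*(u),u)$ is positive definite, and that the map $D(\nabla_x f)$ is Lipschitz continuous on $Z$ with constant $C\ge 0$. Let $u\in U$, let $0<\alpha\le 1/L(u)$, and let $(x^{(k)})_{k\in\mathbb N}$ be generated by gradient descent $x^{(k+1)}=x^{(k)}-\alpha\nabla_x f(x^{(k)},u)$ with $x^{(0)}=a$. Then the sequence $(f(x^{(k)},u))_{k\in\mathbb N}$ is decreasing and converges to $f(x^*(u),u)$. Also, the sequence $(x^{(k)})_{k\in\mathbb N}$ lies in $X(u)$ and converges to $x^*(u)$, and there exist $k_0\ge 0$ and $q_{GD}\in[0,1)$ such that for all $k\ge k_0$, $$\|e^{(k)}\|\le q_{GD}^{\,k-k_0}\,\|e^{(k_0)}\|,\qquad\text{where } e^{(k)}:=x^{(k)}-x^*(u).$$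
   Context: Let $N,P\in\mathbb N$, let $U\subset\mathbb R^P$ be open, non-empty and bounded, and let $f:\mathbb R^N\times\mathbb R^P\to\mathbb R$ be twice continuously differentiable on $\mathbb R^N\times U$. For every $u\in U$ the function $f(\cdot,u)$ is convex and has a unique minimizer over $\mathbb R^N$, denoted $x^*(u)$. $\nabla_x f$ is the gradient in $x$, $\nabla_x^2 f$ the $N\times N$ Hessian in $x$, $\nabla_{xu}f$ the $N\times P$ matrix of derivatives of $\nabla_x f$ with respect to $u$, and $D(\nabla_x f)$ the total derivative of $\nabla_x f$ with respect to $(x,u)$. Norms are Euclidean norms and the induced operator norms. Positive definiteness of $\nabla_x^2 f(x^*(u),u)$ gives, for each $u\in U$, numbers $\varepsilon(u)>0$ and $m(u)>0$ such that $f(\cdot,u)$ is $m(u)$-strongly convex on the closed ball $B_{\varepsilon(u)}(x^*(u))$; these are fixed. A point $a\in\mathbb R^N$ is fixed such that for every $u\in U$ the (bounded) level set $X(u):=\{x\in\mathbb R^N: f(x,u)\le f(a,u)\}$ contains $B_{\varepsilon(u)}(x^*(u))$. Set $Z:=\{(x,u)\in\mathbb R^N\times U: x\in X(u)\}$. $L(u)>0$ is an upper bound on the maximum eigenvalue of $\nabla_x^2 f(x,u)$ over $x\in X(u)$. $\kappa>0$ is an upper bound for $\|\nabla_{xu}f(x,u)\|$ over $(x,u)\in Z$. "Decreasing" is meant in the non-strict sense. *)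

theory Defs
  imports "HOL-Analysis.Analysis"
begin

(* Intended for open S. *)
definition twice_continuously_differentiable_on ::
  "('a::real_normed_vector \<Rightarrow> real) \<Rightarrow> 'a set \<Rightarrow> bool" where
  "twice_continuously_differentiable_on f S \<longleftrightarrow>
     (\<exists>(f' :: 'a \<Rightarrow> 'a \<Rightarrow>\<^sub>L real) (f'' :: 'a \<Rightarrow> 'a \<Rightarrow>\<^sub>L 'a \<Rightarrow>\<^sub>L real).
        (\<forall>z\<in>S. (f has_derivative blinfun_apply (f' z)) (at z)) \<and>
        (\<forall>z\<in>S. (f' has_derivative blinfun_apply (f'' z)) (at z)) \<and>
        continuous_on S f'')"

definition grad_x ::
  "((real^'n) \<times> (real^'p) \<Rightarrow> real) \<Rightarrow> (real^'n) \<times> (real^'p) \<Rightarrow> real^'n" where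
  "grad_x f = (\<lambda>(x, u). \<chi> i. frechet_derivative (\<lambda>y. f (y, u)) (at x) (axis i 1))"

definition hess_x ::
  "((real^'n) \<times> (real^'p) \<Rightarrow> real) \<Rightarrow> (real^'n) \<times> (real^'p) \<Rightarrow> real^'n^'n" where
  "hess_x f = (\<lambda>(x, u). jacobian (\<lambda>y. grad_x f (y, u)) (at x))"

(* The N x P matrix: in "real^'p^'n" the row index is 'n. *)
definition hess_xu ::
  "((real^'n) \<times> (real^'p) \<Rightarrow> real) \<Rightarrow> (real^'n) \<times> (real^'p) \<Rightarrow> real^'p^'n" where
  "hess_xu f = (\<lambda>(x, u). jacobian (\<lambda>v. grad_x f (x, v)) (at u))"

(* Packing the derivative as a bounded linear function makes the metric on its
   values the operator norm distance, with respect to the Euclidean norms. *)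
definition D_grad_x ::
  "((real^'n) \<times> (real^'p) \<Rightarrow> real) \<Rightarrow> (real^'n) \<times> (real^'p) \<Rightarrow>
     ((real^'n) \<times> (real^'p)) \<Rightarrow>\<^sub>L (real^'n)" where
  "D_grad_x f z = Blinfun (frechet_derivative (grad_x f) (at z))"

(* Symmetry is not required; Hessians of twice continuously differentiable functions have it. *)
definition pos_definite :: "real^'n^'n \<Rightarrow> bool" where
  "pos_definite A \<longleftrightarrow> (\<forall>v. v \<noteq> 0 \<longrightarrow> 0 < v \<bullet> (A *v v))"

definition is_eigenvalue :: "real^'n^'n \<Rightarrow> real \<Rightarrow> bool" where
  "is_eigenvalue A c \<longleftrightarrow> (\<exists>v. v \<noteq> 0 \<and> A *v v = c *\<^sub>R v)"

definition strongly_convex_on ::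
  "'a::real_inner set \<Rightarrow> real \<Rightarrow> ('a \<Rightarrow> real) \<Rightarrow> bool" where
  "strongly_convex_on S m g \<longleftrightarrow> convex S \<and>
     (\<forall>x\<in>S. \<forall>y\<in>S. \<forall>t\<in>{0..1}.
        g ((1 - t) *\<^sub>R x + t *\<^sub>R y)
          \<le> (1 - t) * g x + t * g y - m / 2 * t * (1 - t) * (norm (x - y))\<^sup>2)"

definition level_set :: "('a \<times> 'b \<Rightarrow> real) \<Rightarrow> 'a \<Rightarrow> 'b \<Rightarrow> 'a set" where
  "level_set f a u = {x. f (x, u) \<le> f (a, u)}"

definition level_graph :: "('a \<times> 'b \<Rightarrow> real) \<Rightarrow> 'a \<Rightarrow> 'b set \<Rightarrow> ('a \<times> 'b) set" where
  "level_graph f a U = {(x, u). u \<in> U \<and> x \<in> level_set f a u}"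

end

theory Submission
  imports Defs
begin

text \<open>
  Only the behaviour of \<open>g = f(\<cdot>,u)\<close> for the fixed parameter matters. On the level set the
  eigenvalue bound, through symmetry of the Hessian, bounds the second derivative of \<open>g\<close>, so a
  gradient step with \<open>\<alpha> L \<le> 1\<close> stays in the (convex) level set and lowers \<open>g\<close> by at least
  \<open>\<alpha>/2 |\<nabla>g|\<^sup>2\<close>. Hence the gradients along the iteration tend to \<open>0\<close>. Strong convexity near the
  minimizer, propagated outwards by convexity, bounds \<open>|\<nabla>g(y)|\<close> below by a multiple of
  \<open>min |y - x\<^sup>*| \<epsilon>\<close>, which forces convergence without any compactness argument. Once the iterates
  are in the ball, strong convexity gives
  \<open>\<nabla>g(y) \<bullet> (y - x\<^sup>*) \<ge> g(y) - g(x\<^sup>*) + m/4 |y - x\<^sup>*|\<^sup>2\<close>; expanding \<open>|y - \<alpha>\<nabla>g(y) - x\<^sup>*|\<^sup>2\<close> and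
  bounding \<open>\<alpha>\<^sup>2|\<nabla>g(y)|\<^sup>2\<close> by the decrease yields the contraction factor \<open>1 - \<alpha>m/2\<close> for the squared error.
\<close>

section \<open>Symmetry of the second derivative\<close>

lemma has_real_derivative_along_line:
  fixes h :: "'a::real_normed_vector \<Rightarrow> real"
  assumes "(h has_derivative h') (at (y + t *\<^sub>R d))"
  shows "((\<lambda>t. h (y + t *\<^sub>R d)) has_real_derivative h' d) (at t)"
proof -
  interpret bounded_linear h' using assms by (rule has_derivative_bounded_linear)
  have "((\<lambda>t. h (y + t *\<^sub>R d)) has_derivative (\<lambda>s. h' (s *\<^sub>R d))) (at t)"
    by (rule has_derivative_compose[of "\<lambda>t. y + t *\<^sub>R d" "\<lambda>s. s *\<^sub>R d" t UNIV h h'])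
       (use assms in \<open>auto intro!: derivative_eq_intros\<close>)
  then show ?thesis
    by (simp add: has_field_derivative_def scaleR mult_commute_abs)
qed

text \<open>Two applications of the mean value theorem, first along \<open>v\<close>, then along
  \<open>w\<close>. The left side is symmetric in \<open>v\<close> and \<open>w\<close> while the
  right side is not, which yields symmetry of \<open>H\<close> in the limit.\<close>

lemma second_difference_mean_value:
  fixes g :: "'a::real_inner \<Rightarrow> real"
  assumes dg: "\<And>y. (g has_derivative (\<lambda>v. G y \<bullet> v)) (at y)"
    and dG: "\<And>y. (G has_derivative H y) (at y)"
    and s: "0 < s"
  shows "\<exists>a\<in>{0<..<s}. \<exists>b\<in>{0<..<s}.
    g (y + s *\<^sub>R v + s *\<^sub>R w) - g (y + s *\<^sub>R v) - g (y + s *\<^sub>R w) + g y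
      = s\<^sup>2 * (H (y + a *\<^sub>R v + b *\<^sub>R w) w \<bullet> v)"
proof -
  have d1: "((\<lambda>t. g (y + s *\<^sub>R w + t *\<^sub>R v) - g (y + t *\<^sub>R v)) has_real_derivative
      G (y + s *\<^sub>R w + t *\<^sub>R v) \<bullet> v - G (y + t *\<^sub>R v) \<bullet> v) (at t)" for t
    by (intro DERIV_diff has_real_derivative_along_line dg)
  from MVT2[OF s d1] obtain a where a: "0 < a" "a < s" and
    ea: "(g (y + s *\<^sub>R w + s *\<^sub>R v) - g (y + s *\<^sub>R v)) - (g (y + s *\<^sub>R w) - g y)
      = s * (G (y + s *\<^sub>R w + a *\<^sub>R v) \<bullet> v - G (y + a *\<^sub>R v) \<bullet> v)"
    by auto
  have d2: "((\<lambda>t. G (y + a *\<^sub>R v + t *\<^sub>R w) \<bullet> v) has_real_derivative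
      H (y + a *\<^sub>R v + t *\<^sub>R w) w \<bullet> v) (at t)" for t
    by (intro has_real_derivative_along_line[where h="\<lambda>y. G y \<bullet> v" and h'="\<lambda>w. H _ w \<bullet> v"]
        has_derivative_inner_left dG)
  from MVT2[OF s d2] obtain b where b: "0 < b" "b < s" and
    eb: "G (y + a *\<^sub>R v + s *\<^sub>R w) \<bullet> v - G (y + a *\<^sub>R v) \<bullet> v
      = s * (H (y + a *\<^sub>R v + b *\<^sub>R w) w \<bullet> v)"
    by auto
  have "g (y + s *\<^sub>R v + s *\<^sub>R w) - g (y + s *\<^sub>R v) - g (y + s *\<^sub>R w) + g y
      = s\<^sup>2 * (H (y + a *\<^sub>R v + b *\<^sub>R w) w \<bullet> v)"
    using ea eb by (simp add: power2_eq_square algebra_simps)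
  then show ?thesis using a b by (intro bexI[of _ a] bexI[of _ b]) auto
qed

text \<open>Divided by the square of \<open>s\<close>, the second difference tends to the mixed
  derivative in either order; continuity of \<open>H\<close> carries the intermediate points to
  \<open>y\<close>.\<close>

lemma second_derivative_symmetric:
  fixes g :: "'a::real_inner \<Rightarrow> real"
  assumes dg: "\<And>y. (g has_derivative (\<lambda>v. G y \<bullet> v)) (at y)"
    and dG: "\<And>y. (G has_derivative H y) (at y)"
    and cont: "\<And>v w. continuous_on UNIV (\<lambda>y. H y v \<bullet> w)"
  shows "H y v \<bullet> w = H y w \<bullet> v"
proof -
  have lim: "((\<lambda>s. (g (y + s *\<^sub>R v + s *\<^sub>R w) - g (y + s *\<^sub>R v) - g (y + s *\<^sub>R w) + g y) / s\<^sup>2)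
      \<longlongrightarrow> H y w \<bullet> v) (at_right 0)" for v w
  proof -
    \<comment> \<open>One predicate for the whole conclusion lets choice turn the intermediate
      parameters into functions \<open>A\<close>, \<open>B\<close> of \<open>s\<close>, both
      squeezed to 0.\<close>
    define P where "P s a b \<longleftrightarrow> a \<in> {0<..<s} \<and> b \<in> {0<..<s} \<and>
      g (y + s *\<^sub>R v + s *\<^sub>R w) - g (y + s *\<^sub>R v) - g (y + s *\<^sub>R w) + g y
      = s\<^sup>2 * (H (y + a *\<^sub>R v + b *\<^sub>R w) w \<bullet> v)" for s a b
    have "\<exists>a b. P s a b" if "0 < s" for s
    proof -
      have "\<exists>a\<in>{0<..<s}. \<exists>b\<in>{0<..<s}.
        g (y + s *\<^sub>R v + s *\<^sub>R w) - g (y + s *\<^sub>R v) - g (y + s *\<^sub>R w) + g y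
          = s\<^sup>2 * (H (y + a *\<^sub>R v + b *\<^sub>R w) w \<bullet> v)"
        by (rule second_difference_mean_value[where G=G]) (fact dg dG that)+
      then show ?thesis by (elim bexE) (rule exI, rule exI, unfold P_def, intro conjI)
    qed
    then obtain A B where "\<And>s. 0 < s \<Longrightarrow> P s (A s) (B s)" by metis
    then have AB: "\<And>s. 0 < s \<Longrightarrow> A s \<in> {0<..<s} \<and> B s \<in> {0<..<s} \<and>
      g (y + s *\<^sub>R v + s *\<^sub>R w) - g (y + s *\<^sub>R v) - g (y + s *\<^sub>R w) + g y
      = s\<^sup>2 * (H (y + A s *\<^sub>R v + B s *\<^sub>R w) w \<bullet> v)"
      unfolding P_def by blast
    have ev: "\<forall>\<^sub>F s in at_right (0::real). 0 < s" by (simp add: eventually_at_right_less)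
    have A: "(A \<longlongrightarrow> 0) (at_right 0)"
      by (rule tendsto_sandwich[where f="\<lambda>_. 0" and h="\<lambda>s. s"])
         (use AB in \<open>auto intro!: eventually_mono[OF ev] less_imp_le\<close>)
    have B: "(B \<longlongrightarrow> 0) (at_right 0)"
      by (rule tendsto_sandwich[where f="\<lambda>_. 0" and h="\<lambda>s. s"])
         (use AB in \<open>auto intro!: eventually_mono[OF ev] less_imp_le\<close>)
    have "((\<lambda>s. y + A s *\<^sub>R v + B s *\<^sub>R w) \<longlongrightarrow> y + 0 *\<^sub>R v + 0 *\<^sub>R w) (at_right 0)"
      by (intro tendsto_intros A B)
    then have "((\<lambda>s. H (y + A s *\<^sub>R v + B s *\<^sub>R w) w \<bullet> v) \<longlongrightarrow> H y w \<bullet> v) (at_right 0)"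
      using continuous_on_tendsto_compose[OF cont, of "\<lambda>s. y + A s *\<^sub>R v + B s *\<^sub>R w" y _ w v]
      by simp
    then show ?thesis
    proof (rule Lim_transform_eventually)
      show "\<forall>\<^sub>F s in at_right 0. H (y + A s *\<^sub>R v + B s *\<^sub>R w) w \<bullet> v
        = (g (y + s *\<^sub>R v + s *\<^sub>R w) - g (y + s *\<^sub>R v) - g (y + s *\<^sub>R w) + g y) / s\<^sup>2"
      proof (rule eventually_mono[OF ev])
        fix s :: real assume "0 < s"
        then show "H (y + A s *\<^sub>R v + B s *\<^sub>R w) w \<bullet> v
          = (g (y + s *\<^sub>R v + s *\<^sub>R w) - g (y + s *\<^sub>R v) - g (y + s *\<^sub>R w) + g y) / s\<^sup>2"
          by (subst AB[THEN conjunct2, THEN conjunct2]) simp_all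
      qed
    qed
  qed
  have comm: "g (y + s *\<^sub>R w + s *\<^sub>R v) - g (y + s *\<^sub>R w) - g (y + s *\<^sub>R v)
      = g (y + s *\<^sub>R v + s *\<^sub>R w) - g (y + s *\<^sub>R v) - g (y + s *\<^sub>R w)" for s
    by (simp add: add.assoc add.commute[of "s *\<^sub>R w"])
  with lim[of w v] have
    "((\<lambda>s. (g (y + s *\<^sub>R v + s *\<^sub>R w) - g (y + s *\<^sub>R v) - g (y + s *\<^sub>R w) + g y) / s\<^sup>2)
      \<longlongrightarrow> H y v \<bullet> w) (at_right 0)"
    by (simp only: comm)
  then show ?thesis
    using lim[of v w] by (rule tendsto_unique[OF trivial_limit_at_right_real])
qed

section \<open>Eigenvalues and the quadratic form\<close>

text \<open>Rayleigh's principle: the form attains its maximum \<open>c\<close> over the unit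
  sphere, and a maximizer \<open>p\<close> is an eigenvector for \<open>c\<close>, so
  \<open>eig\<close> applies.\<close>

lemma quadratic_form_le_eigenvalue_bound:
  fixes A :: "real^'n^'n"
  assumes sym: "\<And>v w. (A *v v) \<bullet> w = (A *v w) \<bullet> v"
    and eig: "\<And>c. is_eigenvalue A c \<Longrightarrow> c \<le> L"
  shows "(A *v v) \<bullet> v \<le> L * (norm v)\<^sup>2"
proof -
  have "compact (sphere (0::real^'n) 1)" by simp
  moreover have "sphere (0::real^'n) 1 \<noteq> {}" by simp
  moreover have "continuous_on (sphere 0 1) (\<lambda>v. (A *v v) \<bullet> v)"
    by (intro continuous_intros linear_continuous_on linear_linear[THEN iffD2]) auto
  ultimately obtain p where p: "norm p = 1" and max: "\<And>w. norm w = 1 \<Longrightarrow> (A *v w) \<bullet> w \<le> (A *v p) \<bullet> p"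
    using continuous_attains_sup[of "sphere (0::real^'n) 1" "\<lambda>v. (A *v v) \<bullet> v"] by auto
  define c where "c = (A *v p) \<bullet> p"
  have le: "(A *v w) \<bullet> w \<le> c * (norm w)\<^sup>2" for w
  proof (cases "w = 0")
    case False
    have "(A *v (w /\<^sub>R norm w)) \<bullet> (w /\<^sub>R norm w) \<le> c"
      unfolding c_def using False by (intro max) simp
    then show ?thesis using False
      by (simp add: matrix_vector_mult_scaleR field_simps power2_eq_square)
  qed simp
  have "A *v p = c *\<^sub>R p"
  proof (rule ccontr)
    define r where "r = A *v p - c *\<^sub>R p"
    assume "A *v p \<noteq> c *\<^sub>R p"
    then have r: "r \<bullet> r > 0" by (simp add: r_def)
    \<comment> \<open>The form \<open>c |w|\<^sup>2 - A w \<bullet> w\<close> is nonnegative and vanishes at \<open>p\<close>; moving from \<open>p\<close>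
      in the direction of its residual \<open>r\<close> would make it negative.\<close>
    define q where "q = c * (norm r)\<^sup>2 - (A *v r) \<bullet> r"
    have q: "q \<ge> 0" using le[of r] by (simp add: q_def)
    \<comment> \<open>This is \<open>le\<close> at \<open>p + t *\<^sub>R r\<close>: the constant
      terms cancel because \<open>p\<close> is a unit vector, and symmetry merges the two cross
      terms.\<close>
    have *: "2 * t * (r \<bullet> r) \<le> t\<^sup>2 * q" for t
    proof -
      have "r \<bullet> r = (A *v p) \<bullet> r - c * (p \<bullet> r)"
        by (simp add: r_def inner_diff_left)
      moreover have "p \<bullet> p = 1" using p by (simp add: norm_eq_1)
      moreover have "(A *v r) \<bullet> p = (A *v p) \<bullet> r" by (rule sym)
      ultimately show ?thesis using le[of "p + t *\<^sub>R r"]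
        by (simp add: q_def c_def[symmetric] power2_norm_eq_inner matrix_vector_right_distrib
            matrix_vector_mult_scaleR inner_add_left inner_add_right inner_commute[of r p])
          (simp add: algebra_simps power2_eq_square)
    qed
    \<comment> \<open>A linear term cannot stay below a quadratic one near 0. This \<open>t\<close>
      makes \<open>t * (q + 1)\<close> equal to \<open>r \<bullet> r\<close>; the added 1 keeps the
      denominator positive when \<open>q\<close> is 0.\<close>
    define t where "t = (r \<bullet> r) / (q + 1)"
    have t: "t > 0" using r q by (simp add: t_def)
    have "2 * (r \<bullet> r) \<le> t * q" using *[of t] t by (simp add: power2_eq_square)
    also have "\<dots> \<le> t * (q + 1)" using t by simp
    also have "\<dots> = r \<bullet> r" using q by (simp add: t_def)
    finally show False using r by simp
  qed
  then have "is_eigenvalue A c" using p unfolding is_eigenvalue_def by (intro exI[of _ p]) auto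
  then have "c \<le> L" by (rule eig)
  then show ?thesis using le[of v] by (meson mult_right_mono order_trans zero_le_power2)
qed

section \<open>Convexity and the gradient step\<close>

lemma convex_on_above_gradient:
  fixes g :: "'a::real_inner \<Rightarrow> real"
  assumes conv: "convex_on UNIV g"
    and dg: "(g has_derivative (\<lambda>v. G y \<bullet> v)) (at y)"
  shows "g z \<ge> g y + G y \<bullet> (z - y)"
proof -
  have "convex_on UNIV (\<lambda>t. g (y + t *\<^sub>R (z - y)))"
  proof (rule convex_onI)
    fix t a b :: real assume t: "0 < t" "t < 1"
    have "y + ((1 - t) *\<^sub>R a + t *\<^sub>R b) *\<^sub>R (z - y)
        = (1 - t) *\<^sub>R (y + a *\<^sub>R (z - y)) + t *\<^sub>R (y + b *\<^sub>R (z - y))"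
      by (simp add: algebra_simps)
    then show "g (y + ((1 - t) *\<^sub>R a + t *\<^sub>R b) *\<^sub>R (z - y))
        \<le> (1 - t) * g (y + a *\<^sub>R (z - y)) + t * g (y + b *\<^sub>R (z - y))"
      using convex_onD[OF conv, of t] t by simp
  qed simp
  moreover have "((\<lambda>t. g (y + t *\<^sub>R (z - y))) has_real_derivative G y \<bullet> (z - y)) (at 0)"
    by (rule has_real_derivative_along_line[where h'="\<lambda>v. G y \<bullet> v"]) (use dg in simp)
  ultimately show ?thesis
    using convex_on_imp_above_tangent[of UNIV "\<lambda>t. g (y + t *\<^sub>R (z - y))" 0 1 "G y \<bullet> (z - y)"]
    by simp
qed

text \<open>The Hessian bound is available only on the sublevel set of \<open>y\<close>, so the
  usual descent estimate first covers steps known to end there; continuity then shows that the full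
  step is one of them.\<close>

lemma gradient_step_decrease:
  fixes g :: "'a::real_inner \<Rightarrow> real"
  assumes conv: "convex_on UNIV g"
    and dg: "\<And>y. (g has_derivative (\<lambda>v. G y \<bullet> v)) (at y)"
    and dG: "\<And>y. (G has_derivative H y) (at y)"
    and bound: "\<And>z v. g z \<le> g y \<Longrightarrow> H z v \<bullet> v \<le> L * (norm v)\<^sup>2"
    and \<alpha>: "0 < \<alpha>" "\<alpha> * L \<le> 1"
  shows "g (y - \<alpha> *\<^sub>R G y) \<le> g y - \<alpha> / 2 * (norm (G y))\<^sup>2"
proof (cases "G y = 0")
  case False
  define d where "d = - G y"
  define n2 where "n2 = (norm (G y))\<^sup>2"
  have n2: "n2 > 0" using False by (simp add: n2_def)
  have nd: "(norm d)\<^sup>2 = n2" "G y \<bullet> d = - n2" by (simp_all add: d_def n2_def power2_norm_eq_inner)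
  define h where "h t = g (y + t *\<^sub>R d)" for t
  have dh: "(h has_real_derivative G (y + t *\<^sub>R d) \<bullet> d) (at t)" for t
    unfolding h_def by (rule has_real_derivative_along_line[OF dg])
  have dh': "((\<lambda>t. G (y + t *\<^sub>R d) \<bullet> d) has_real_derivative H (y + t *\<^sub>R d) d \<bullet> d) (at t)" for t
    by (intro has_real_derivative_along_line[where h="\<lambda>y. G y \<bullet> d" and h'="\<lambda>w. H _ w \<bullet> d"]
        has_derivative_inner_left dG)
  have step: "h \<tau> \<le> h 0 - \<tau> / 2 * n2" if \<tau>: "0 < \<tau>" "\<tau> \<le> \<alpha>" "h \<tau> \<le> h 0" for \<tau>
  proof -
    \<comment> \<open>The derivatives of \<open>h\<close> in the indexing of Taylor's theorem;
      indices above 2 merely repeat the second derivative.\<close>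
    define diff where "diff m = (if m = (0::nat) then h else if m = 1 then (\<lambda>t. G (y + t *\<^sub>R d) \<bullet> d)
      else (\<lambda>t. H (y + t *\<^sub>R d) d \<bullet> d))" for m
    have "\<exists>t>0. t < \<tau> \<and> h \<tau> = (\<Sum>m<2. diff m 0 / fact m * (\<tau> - 0) ^ m) + diff 2 t / fact 2 * (\<tau> - 0)\<^sup>2"
      by (rule Taylor_up[where a=0]) (use \<tau> dh dh' in \<open>auto simp: diff_def less_2_cases_iff\<close>)
    then obtain t where t: "0 < t" "t < \<tau>"
      and eq: "h \<tau> = h 0 - \<tau> * n2 + (H (y + t *\<^sub>R d) d \<bullet> d) / 2 * \<tau>\<^sup>2"
      by (auto simp: diff_def numeral_2_eq_2 nd)
    \<comment> \<open>Both ends of the segment lie in the sublevel set, so by convexity the Taylor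
      point does too, and the Hessian bound holds there.\<close>
    have "h t \<le> h 0"
    proof -
      have "y + t *\<^sub>R d = (1 - t / \<tau>) *\<^sub>R y + (t / \<tau>) *\<^sub>R (y + \<tau> *\<^sub>R d)"
        using \<tau> by (simp add: algebra_simps)
      then have "h t \<le> (1 - t / \<tau>) * h 0 + (t / \<tau>) * h \<tau>"
        using convex_onD[OF conv, of "t / \<tau>" y "y + \<tau> *\<^sub>R d"] t by (simp add: h_def)
      also have "\<dots> \<le> (1 - t / \<tau>) * h 0 + (t / \<tau>) * h 0"
        using t \<tau> by (intro add_left_mono mult_left_mono) auto
      finally show ?thesis by (simp add: algebra_simps)
    qed
    then have "H (y + t *\<^sub>R d) d \<bullet> d \<le> L * n2"
      using bound[of "y + t *\<^sub>R d" d] nd by (simp add: h_def)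
    then have "(H (y + t *\<^sub>R d) d \<bullet> d) / 2 * \<tau>\<^sup>2 \<le> (L * n2) / 2 * \<tau>\<^sup>2"
      by (intro mult_right_mono divide_right_mono) auto
    also have "\<dots> = (\<tau> * L) * (\<tau> / 2 * n2)" by (simp add: power2_eq_square)
    also have "\<dots> \<le> 1 * (\<tau> / 2 * n2)"
    proof (intro mult_right_mono)
      show "\<tau> * L \<le> 1"
      proof (cases "L \<ge> 0")
        case True
        then have "\<tau> * L \<le> \<alpha> * L" using \<tau> by (intro mult_right_mono) auto
        then show ?thesis using \<alpha> by simp
      next
        case False
        then show ?thesis using \<tau> by (smt (verit) mult_pos_neg)
      qed
    qed (use \<tau> n2 in auto)
    finally show ?thesis using eq by simp
  qed
  \<comment> \<open>If the step left the sublevel set, \<open>h\<close> would return to the value \<open>h 0\<close> at some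
    \<open>\<tau> > 0\<close>, contradicting the strict decrease in \<open>step\<close>.\<close>
  have "h \<alpha> \<le> h 0"
  proof (rule ccontr)
    assume "\<not> h \<alpha> \<le> h 0"
    then have gt: "h \<alpha> > h 0" by simp
    have "(h has_real_derivative - n2) (at 0)" using dh[of 0] by (simp add: nd)
    from DERIV_neg_dec_right[OF this] n2 obtain \<delta> where \<delta>: "\<delta> > 0"
      and dec: "\<And>s. 0 < s \<Longrightarrow> s < \<delta> \<Longrightarrow> h s < h 0" by auto
    \<comment> \<open>Starting the intermediate value argument at a positive \<open>s\<close> rules
      out the trivial solution \<open>\<tau> = 0\<close>.\<close>
    define s where "s = min (\<delta> / 2) \<alpha>"
    have "h s \<le> h 0" "0 < s" "s \<le> \<alpha>"
      using \<delta> \<alpha> dec[of s] by (auto simp: s_def min_def)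
    moreover have "continuous_on {s..\<alpha>} h"
      using dh by (intro DERIV_continuous_on) (auto intro: has_field_derivative_at_within)
    ultimately obtain \<tau> where "s \<le> \<tau>" "\<tau> \<le> \<alpha>" "h \<tau> = h 0"
      using IVT'[of h s "h 0" \<alpha>] gt by auto
    then show False using step[of \<tau>] \<open>0 < s\<close> n2 by (smt (verit) mult_pos_pos half_gt_zero)
  qed
  from step[OF \<alpha>(1) order_refl this] show ?thesis by (simp add: h_def d_def n2_def)
qed simp

section \<open>Convergence of gradient descent\<close>

text \<open>Second-order information enters only through \<open>decrease\<close>. Convergence comes
  first because it supplies \<open>k0\<close>, from which on the iterates lie in the ball where the
  contraction holds.\<close>

lemma gradient_descent_linear_convergence:
  fixes g :: "'a::real_inner \<Rightarrow> real"
  assumes conv: "convex_on UNIV g"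
    and dg: "\<And>y. (g has_derivative (\<lambda>v. G y \<bullet> v)) (at y)"
    and min: "\<And>y. g p \<le> g y"
    and sc: "strongly_convex_on (cball p \<epsilon>) m g"
    and pos: "0 < \<epsilon>" "0 < m" "0 < \<alpha>"
    and x: "\<And>k. x (Suc k) = x k - \<alpha> *\<^sub>R G (x k)"
    and decrease: "\<And>k. g (x (Suc k)) \<le> g (x k) - \<alpha> / 2 * (norm (G (x k)))\<^sup>2"
  shows "x \<longlonglongrightarrow> p"
    and "\<exists>k0 q. 0 \<le> q \<and> q < 1 \<and> (\<forall>k\<ge>k0. norm (x k - p) \<le> q ^ (k - k0) * norm (x k0 - p))"
proof -
  \<comment> \<open>Strong convexity is used only at \<open>t = 1/2\<close> against the minimizer;
    \<open>m / 8\<close> is \<open>m / 2\<close> times 1/4, and doubling it gives the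
    \<open>m / 4\<close> below.\<close>
  have mid: "g ((1/2) *\<^sub>R y + (1/2) *\<^sub>R p) \<le> g y / 2 + g p / 2 - m / 8 * (norm (y - p))\<^sup>2"
    if "y \<in> cball p \<epsilon>" for y
  proof -
    have "p \<in> cball p \<epsilon>" "(1/2::real) \<in> {0..1}" using pos by auto
    then have "g ((1 - 1/2) *\<^sub>R y + (1/2) *\<^sub>R p)
        \<le> (1 - 1/2) * g y + 1/2 * g p - m / 2 * (1/2) * (1 - 1/2) * (norm (y - p))\<^sup>2"
      using sc that unfolding strongly_convex_on_def by blast
    then show ?thesis by simp
  qed
  have sgrowth: "g y - g p \<ge> m / 4 * (norm (y - p))\<^sup>2" if "y \<in> cball p \<epsilon>" for y
    using mid[OF that] min[of "(1/2) *\<^sub>R y + (1/2) *\<^sub>R p"] by simp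
  have above: "G y \<bullet> (y - z) \<ge> g y - g z" for y z
    using convex_on_above_gradient[where G=G and y=y and z=z, OF conv dg] by (simp add: inner_diff_right)
  \<comment> \<open>The tangent inequality at \<open>y\<close> towards the midpoint, doubled: unlike
    the tangent towards \<open>p\<close>, it picks up the quadratic gain from
    \<open>mid\<close>.\<close>
  have smono: "G y \<bullet> (y - p) \<ge> g y - g p + m / 4 * (norm (y - p))\<^sup>2" if "y \<in> cball p \<epsilon>" for y
  proof -
    have "y - ((1/2) *\<^sub>R y + (1/2) *\<^sub>R p) = (1/2) *\<^sub>R (y - p)"
      by (simp add: algebra_simps flip: scaleR_add_left)
    then show ?thesis
      using mid[OF that] above[of y "(1/2) *\<^sub>R y + (1/2) *\<^sub>R p"] by simp
  qed
  have Ggrowth: "norm (G y) \<ge> m / 4 * min (norm (y - p)) \<epsilon>" for y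
  proof (cases "y = p")
    case False
    then have n: "norm (y - p) > 0" by simp
    \<comment> \<open>This \<open>t\<close> pulls \<open>y\<close> towards \<open>p\<close> just far
      enough to land in the ball. Growth at the resulting \<open>z\<close> passes back to
      \<open>y\<close> by convexity, then to the gradient by Cauchy-Schwarz.\<close>
    define t where "t = min 1 (\<epsilon> / norm (y - p))"
    have t: "0 < t" "t \<le> 1" using pos n by (auto simp: t_def)
    have tn: "t * norm (y - p) = min (norm (y - p)) \<epsilon>"
      using n by (auto simp: t_def min_def field_simps)
    define z where "z = (1 - t) *\<^sub>R p + t *\<^sub>R y"
    have zp: "z - p = t *\<^sub>R (y - p)" by (simp add: z_def algebra_simps)
    then have nz: "norm (z - p) = min (norm (y - p)) \<epsilon>" using t tn by simp
    then have "z \<in> cball p \<epsilon>" by (simp add: dist_norm norm_minus_commute)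
    from sgrowth[OF this] have "m / 4 * (t * norm (y - p))\<^sup>2 \<le> g z - g p"
      using nz tn by simp
    also have "\<dots> \<le> t * (g y - g p)"
      using convex_onD[OF conv, of t p y] t by (simp add: z_def algebra_simps)
    also have "\<dots> \<le> t * (norm (G y) * norm (y - p))"
      using above[of y p] norm_cauchy_schwarz[of "G y" "y - p"] t by (intro mult_left_mono) auto
    finally have "m / 4 * (t * norm (y - p)) * (t * norm (y - p)) \<le> norm (G y) * (t * norm (y - p))"
      by (simp add: power2_eq_square algebra_simps)
    then show ?thesis using t n tn by (metis mult_le_cancel_right_pos mult_pos_pos)
  qed (use pos in simp)
  have "decseq (\<lambda>k. g (x k))"
    unfolding decseq_Suc_iff using decrease pos
    by (smt (verit) mult_nonneg_nonneg zero_le_power2 half_gt_zero)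
  then obtain l where l: "(\<lambda>k. g (x k)) \<longlonglongrightarrow> l"
    using decseq_convergent[of "\<lambda>k. g (x k)" "g p"] min by metis
  \<comment> \<open>The limit \<open>l\<close> is not yet known to be the minimum; it suffices that
    consecutive values approach each other, since their differences dominate the squared
    gradients.\<close>
  have upper: "(\<lambda>k. 2 / \<alpha> * (g (x k) - g (x (Suc k)))) \<longlonglongrightarrow> 2 / \<alpha> * (l - l)"
    by (intro tendsto_mult tendsto_const tendsto_diff l LIMSEQ_Suc[OF l])
  have "(norm (G (x k)))\<^sup>2 \<le> 2 / \<alpha> * (g (x k) - g (x (Suc k)))" for k
    using decrease[of k] pos by (simp add: field_simps)
  then have "(\<lambda>k. (norm (G (x k)))\<^sup>2) \<longlonglongrightarrow> 0"
    by (intro tendsto_sandwich[OF _ _ tendsto_const[of 0] upper[simplified]]) auto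
  then have "(\<lambda>k. sqrt ((norm (G (x k)))\<^sup>2)) \<longlonglongrightarrow> sqrt 0" by (rule tendsto_real_sqrt)
  then have G0: "(\<lambda>k. norm (G (x k))) \<longlonglongrightarrow> 0" by simp
  show lim: "x \<longlonglongrightarrow> p"
  proof (rule tendstoI)
    fix e :: real assume e: "0 < e"
    \<comment> \<open>With the threshold capped at \<open>\<epsilon>\<close>, the strict inequality
      between the two minima forces the left one to be the distance itself.\<close>
    have "\<forall>\<^sub>F k in sequentially. norm (G (x k)) < m / 4 * min e \<epsilon>"
      using e pos by (intro order_tendstoD[OF G0]) auto
    then show "\<forall>\<^sub>F k in sequentially. dist (x k) p < e"
    proof (rule eventually_mono)
      fix k assume "norm (G (x k)) < m / 4 * min e \<epsilon>"
      then have "m / 4 * min (norm (x k - p)) \<epsilon> < m / 4 * min e \<epsilon>" using Ggrowth[of "x k"] by simp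
      then have "min (norm (x k - p)) \<epsilon> < min e \<epsilon>" using pos by simp
      then show "dist (x k) p < e" by (simp add: dist_norm min_def split: if_splits)
    qed
  qed
  have "\<forall>\<^sub>F k in sequentially. dist (x k) p < \<epsilon>" using lim pos(1) by (rule tendstoD)
  then obtain k0 where k0: "\<And>k. k \<ge> k0 \<Longrightarrow> x k \<in> cball p \<epsilon>"
    unfolding eventually_sequentially by (metis dist_commute less_imp_le mem_cball)
  \<comment> \<open>The squared error shrinks by \<open>1 - \<alpha> * m / 2\<close>, which may be
    negative; \<open>max 0\<close> keeps \<open>q\<close> nonnegative, as \<open>sqrt\<close> is
    negative on negative arguments.\<close>
  define q where "q = sqrt (max 0 (1 - \<alpha> * m / 2))"
  have q: "0 \<le> q" "q < 1" using pos by (auto simp: q_def)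
  have contract: "norm (x (Suc k) - p) \<le> q * norm (x k - p)" if "k \<ge> k0" for k
  proof -
    define e where "e = x k - p"
    have "x (Suc k) - p = e - \<alpha> *\<^sub>R G (x k)" by (simp add: x e_def)
    then have "(norm (x (Suc k) - p))\<^sup>2
        = (norm e)\<^sup>2 - 2 * \<alpha> * (G (x k) \<bullet> e) + \<alpha> * (\<alpha> * (norm (G (x k)))\<^sup>2)"
      by (simp only: power2_norm_eq_inner)
        (simp add: inner_diff_left inner_diff_right inner_commute)
    \<comment> \<open>The gap \<open>g (x k) - g p\<close> enters once from \<open>smono\<close> and
      once, with opposite sign, from \<open>decrease\<close>; the two cancel and only the quadratic
      gain remains.\<close>
    also have "\<dots> \<le> (norm e)\<^sup>2 - 2 * \<alpha> * (g (x k) - g p + m / 4 * (norm e)\<^sup>2)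
        + \<alpha> * (2 * (g (x k) - g p))"
    proof (intro add_mono diff_mono mult_left_mono order_refl)
      show "g (x k) - g p + m / 4 * (norm e)\<^sup>2 \<le> G (x k) \<bullet> e"
        using smono[OF k0[OF that]] by (simp add: e_def)
      show "\<alpha> * (norm (G (x k)))\<^sup>2 \<le> 2 * (g (x k) - g p)"
        using decrease[of k] min[of "x (Suc k)"] by simp
    qed (use pos in auto)
    also have "\<dots> = (1 - \<alpha> * m / 2) * (norm e)\<^sup>2" by (simp add: algebra_simps)
    also have "\<dots> \<le> q\<^sup>2 * (norm e)\<^sup>2" by (intro mult_right_mono) (auto simp: q_def)
    finally have "(norm (x (Suc k) - p))\<^sup>2 \<le> (q * norm e)\<^sup>2" by (simp add: power_mult_distrib)
    then have "norm (x (Suc k) - p) \<le> q * norm e"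
      by (rule power2_le_imp_le) (simp add: q)
    then show ?thesis by (simp only: e_def)
  qed
  have "norm (x k - p) \<le> q ^ (k - k0) * norm (x k0 - p)" if "k \<ge> k0" for k
    using that
  proof (induction k rule: dec_induct)
    case (step k)
    have "norm (x (Suc k) - p) \<le> q * (q ^ (k - k0) * norm (x k0 - p))"
      using contract[of k] step q by (meson mult_left_mono order_trans)
    then show ?case using step by (simp add: Suc_diff_le)
  qed simp
  then show "\<exists>k0 q. 0 \<le> q \<and> q < 1 \<and> (\<forall>k\<ge>k0. norm (x k - p) \<le> q ^ (k - k0) * norm (x k0 - p))"
    using q by blast
qed

section \<open>Derivatives of the section at a fixed parameter\<close>

text \<open>Links the coordinatewise \<open>grad_x\<close> and \<open>hess_x\<close> to the abstract
  derivatives of \<open>f\<close>, restricted to directions \<open>(v, 0)\<close>.\<close>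

lemma twice_continuously_differentiable_section:
  fixes f :: "(real^'n) \<times> (real^'p) \<Rightarrow> real"
  assumes "twice_continuously_differentiable_on f (UNIV \<times> U)" and u: "u \<in> U"
  shows "((\<lambda>y. f (y, u)) has_derivative (\<lambda>v. grad_x f (y, u) \<bullet> v)) (at y)"
    and "((\<lambda>y. grad_x f (y, u)) has_derivative (\<lambda>v. hess_x f (y, u) *v v)) (at y)"
    and "continuous_on UNIV (\<lambda>y. (hess_x f (y, u) *v v) \<bullet> w)"
proof -
  obtain f' :: "(real^'n) \<times> (real^'p) \<Rightarrow> ((real^'n) \<times> (real^'p)) \<Rightarrow>\<^sub>L real" and f'' ::
      "(real^'n) \<times> (real^'p) \<Rightarrow> ((real^'n) \<times> (real^'p)) \<Rightarrow>\<^sub>L ((real^'n) \<times> (real^'p)) \<Rightarrow>\<^sub>L real"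
    where "\<forall>z\<in>UNIV \<times> U. (f has_derivative blinfun_apply (f' z)) (at z)"
      and "\<forall>z\<in>UNIV \<times> U. (f' has_derivative blinfun_apply (f'' z)) (at z)"
      and c: "continuous_on (UNIV \<times> U) f''"
    using assms(1) unfolding twice_continuously_differentiable_on_def by (elim exE conjE)
  then have d1: "(f has_derivative blinfun_apply (f' (y, u))) (at (y, u))"
    and d2: "(f' has_derivative blinfun_apply (f'' (y, u))) (at (y, u))" for y
    using u by simp_all
  have pair: "((\<lambda>y::real^'n. (y, u)) has_derivative (\<lambda>v. (v, 0))) (at y)" for y
    by (auto intro!: derivative_eq_intros)
  have s1: "((\<lambda>y. f (y, u)) has_derivative (\<lambda>v. blinfun_apply (f' (y, u)) (v, 0))) (at y)" for y
    by (rule has_derivative_compose[OF pair d1])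
  have g: "grad_x f (y, u) = (\<chi> i. blinfun_apply (f' (y, u)) (axis i 1, 0))" for y
    unfolding grad_x_def using frechet_derivative_at[OF s1, symmetric] by simp
  have gi: "grad_x f (y, u) \<bullet> v = blinfun_apply (f' (y, u)) (v, 0)" for y v
  proof -
    interpret bounded_linear "\<lambda>v. blinfun_apply (f' (y, u)) (v, 0)" by (rule has_derivative_bounded_linear[OF s1])
    have "blinfun_apply (f' (y, u)) (v, 0) = blinfun_apply (f' (y, u)) ((\<Sum>i\<in>UNIV. (v $ i) *\<^sub>R axis i 1), 0)"
      by (simp add: basis_expansion flip: scalar_mult_eq_scaleR)
    also have "\<dots> = (\<Sum>i\<in>UNIV. v $ i * blinfun_apply (f' (y, u)) (axis i 1, 0))"
      by (simp add: sum scaleR)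
    finally show ?thesis by (simp add: g inner_vec_def mult.commute)
  qed
  show "((\<lambda>y. f (y, u)) has_derivative (\<lambda>v. grad_x f (y, u) \<bullet> v)) (at y)" for y
    using s1 by (simp add: gi)
  have s2: "((\<lambda>y. f' (y, u)) has_derivative (\<lambda>v. blinfun_apply (f'' (y, u)) (v, 0))) (at y)" for y
    by (rule has_derivative_compose[OF pair d2])
  have s3: "((\<lambda>y. blinfun_apply (f' (y, u)) (w, 0)) has_derivative (\<lambda>v. blinfun_apply (blinfun_apply (f'' (y, u)) (v, 0)) (w, 0))) (at y)" for y w
    using bounded_linear.has_derivative[OF bounded_linear_apply_blinfun s2] .
  have "(\<lambda>y. grad_x f (y, u)) differentiable at y" for y
  proof -
    have "((\<lambda>y. grad_x f (y, u)) has_derivative (\<lambda>v. \<chi> i. blinfun_apply (blinfun_apply (f'' (y, u)) (v, 0)) (axis i 1, 0))) (at y)"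
      by (rule has_derivative_componentwise_within[THEN iffD2])
         (auto simp: Basis_vec_def inner_axis gi s3)
    then show ?thesis by (rule differentiableI)
  qed
  then show s4: "((\<lambda>y. grad_x f (y, u)) has_derivative (\<lambda>v. hess_x f (y, u) *v v)) (at y)" for y
    by (simp add: jacobian_works hess_x_def)
  \<comment> \<open>Uniqueness of derivatives identifies the Hessian form with \<open>f''\<close>,
    from which it inherits continuity.\<close>
  have "(hess_x f (y, u) *v v) \<bullet> w = blinfun_apply (blinfun_apply (f'' (y, u)) (v, 0)) (w, 0)" for y
    using has_derivative_unique[OF has_derivative_inner_left[OF s4[of y], of w] s3[of w y, folded gi]]
    by metis
  moreover have "continuous_on UNIV (\<lambda>y. f'' (y, u))"
    by (rule continuous_on_compose2[OF c]) (auto intro!: continuous_intros simp: u)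
  ultimately show "continuous_on UNIV (\<lambda>y. (hess_x f (y, u) *v v) \<bullet> w)"
    by (auto intro!: continuous_intros)
qed

theorem mainTheorem1:
  fixes f :: "(real^'n) \<times> (real^'p) \<Rightarrow> real"
    and U :: "(real^'p) set"
    and xstar :: "real^'p \<Rightarrow> real^'n"
    and \<epsilon> m L :: "real^'p \<Rightarrow> real"
    and a :: "real^'n"
    and \<kappa> C \<alpha> :: real
    and u :: "real^'p"
    and x :: "nat \<Rightarrow> real^'n"
  assumes "open U" "U \<noteq> {}" "bounded U"
    and "twice_continuously_differentiable_on f (UNIV \<times> U)"
    and "\<forall>v\<in>U. convex_on UNIV (\<lambda>y. f (y, v))"
    and "\<forall>v\<in>U. \<exists>!y. is_arg_min (\<lambda>y. f (y, v)) (\<lambda>_. True) y"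
    and "\<forall>v\<in>U. is_arg_min (\<lambda>y. f (y, v)) (\<lambda>_. True) (xstar v)"
    and "\<forall>v\<in>U. 0 < \<epsilon> v \<and> 0 < m v \<and>
           strongly_convex_on (cball (xstar v) (\<epsilon> v)) (m v) (\<lambda>y. f (y, v))"
    and "\<forall>v\<in>U. cball (xstar v) (\<epsilon> v) \<subseteq> level_set f a v"
    and "\<forall>v\<in>U. 0 < L v \<and>
           (\<forall>y\<in>level_set f a v. \<forall>c. is_eigenvalue (hess_x f (y, v)) c \<longrightarrow> c \<le> L v)"
    and "0 < \<kappa>"
    and "\<forall>z\<in>level_graph f a U. onorm ((*v) (hess_xu f z)) \<le> \<kappa>"
    and "\<forall>v\<in>U. pos_definite (hess_x f (xstar v, v))"
    and "0 \<le> C" "C-lipschitz_on (level_graph f a U) (D_grad_x f)"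
    and "u \<in> U" "0 < \<alpha>" "\<alpha> \<le> 1 / L u"
    and "x 0 = a"
    and "\<forall>k. x (Suc k) = x k - \<alpha> *\<^sub>R grad_x f (x k, u)"
  shows "decseq (\<lambda>k. f (x k, u))
    \<and> (\<lambda>k. f (x k, u)) \<longlonglongrightarrow> f (xstar u, u)
    \<and> (\<forall>k. x k \<in> level_set f a u)
    \<and> x \<longlonglongrightarrow> xstar u
    \<and> (\<exists>k0 q. 0 \<le> q \<and> q < 1 \<and>
         (\<forall>k\<ge>k0. norm (x k - xstar u) \<le> q ^ (k - k0) * norm (x k0 - xstar u)))"
proof -
  note dtwice = twice_continuously_differentiable_section[OF assms(4) \<open>u \<in> U\<close>]
  have conv: "convex_on UNIV (\<lambda>y. f (y, u))" using assms by blast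
  have min: "f (xstar u, u) \<le> f (y, u)" for y
    using assms(7) \<open>u \<in> U\<close> by (auto simp: is_arg_min_def not_less)
  have L: "0 < L u" "\<And>y c. f (y, u) \<le> f (a, u) \<Longrightarrow> is_eigenvalue (hess_x f (y, u)) c \<Longrightarrow> c \<le> L u"
    using assms(10) \<open>u \<in> U\<close> by (auto simp: level_set_def)
  have bound: "(hess_x f (y, u) *v v) \<bullet> v \<le> L u * (norm v)\<^sup>2" if "f (y, u) \<le> f (a, u)" for y v
    using second_derivative_symmetric[OF dtwice] L(2)[OF that]
    by (intro quadratic_form_le_eigenvalue_bound) blast+
  have "\<alpha> * L u \<le> 1" using assms(18) L(1) by (simp add: field_simps)
  \<comment> \<open>If \<open>x k\<close> lies in the level set of \<open>a\<close>, so does its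
    whole sublevel set, where \<open>bound\<close> holds. The induction for \<open>level\<close>
    then discharges the condition.\<close>
  then have step: "f (x (Suc k), u) \<le> f (x k, u) - \<alpha> / 2 * (norm (grad_x f (x k, u)))\<^sup>2"
    if "f (x k, u) \<le> f (a, u)" for k
    unfolding assms(20)[rule_format]
    by (intro gradient_step_decrease[OF conv dtwice(1,2)] \<open>0 < \<alpha>\<close>)
       (use that in \<open>auto intro!: bound intro: order_trans\<close>)
  have level: "f (x k, u) \<le> f (a, u)" for k
  proof (induction k)
    case (Suc k)
    moreover have "0 \<le> \<alpha> / 2 * (norm (grad_x f (x k, u)))\<^sup>2" using \<open>0 < \<alpha>\<close> by simp
    ultimately show ?case using step[of k] by linarith
  qed (simp add: assms(19))
  note decrease = step[OF level]
  have "decseq (\<lambda>k. f (x k, u))"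
    unfolding decseq_Suc_iff
  proof
    fix k
    have "0 \<le> \<alpha> / 2 * (norm (grad_x f (x k, u)))\<^sup>2" using \<open>0 < \<alpha>\<close> by simp
    then show "f (x (Suc k), u) \<le> f (x k, u)" using decrease[of k] by linarith
  qed
  moreover have lin: "x \<longlonglongrightarrow> xstar u"
    "\<exists>k0 q. 0 \<le> q \<and> q < 1 \<and>
      (\<forall>k\<ge>k0. norm (x k - xstar u) \<le> q ^ (k - k0) * norm (x k0 - xstar u))"
    using assms(8,20) \<open>u \<in> U\<close> \<open>0 < \<alpha>\<close> min decrease
      gradient_descent_linear_convergence[where g="\<lambda>y. f (y, u)" and G="\<lambda>y. grad_x f (y, u)"
        and p="xstar u" and \<epsilon>="\<epsilon> u" and m="m u" and \<alpha>=\<alpha> and x=x, OF conv dtwice(1)]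
    by simp_all
  moreover have "(\<lambda>k. f (x k, u)) \<longlonglongrightarrow> f (xstar u, u)"
    by (rule isCont_tendsto_compose[OF has_derivative_continuous[OF dtwice(1)] lin(1)])
  ultimately show ?thesis using level by (simp add: level_set_def)
qed

end
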